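(* Let $\boldsymbol f^{nc}$ be non-cooperative equilibrium fare parameters and let $(\boldsymbol f^a,\Lambda^a)$ be optimal allied fare parameters and discount multiplier, for transit priority weights $\boldsymbol\pi=(\pi^{PX},\pi^{PR},\pi^{VM})$. Let $\Theta_k(\boldsymbol f^{nc})$ be the non-cooperative profit of operator $k\in\mathcal{O}$ and $\Theta(\boldsymbol f^a,\Lambda^a;\boldsymbol\pi)$ the total profit of the alliance, and let $$\delta=\Theta(\boldsymbol f^a,\Lambda^a;\boldsymbol\pi)-\sum_{k\in\mathcal{O}}\Theta_k(\boldsymbol f^{nc}).$$ Define the profit allocations $\Phi_k$ ($k\in\mathcal{O}$), as functions of $\big((\Theta_l(\boldsymbol f^{nc}))_{l\in\mathcal{O}},\Theta(\boldsymbol f^a,\Lambda^a;\boldsymbol\pi)\big)$, by $$\Phi_{TR}=\begin{cases}\Theta_{TR}(\boldsymbol f^{nc})+\dfrac{\delta}{|\mathcal{O}|}&\text{if }\delta\ge 0,\\[2mm]\Theta(\boldsymbol f^a,\Lambda^a;\boldsymbol\pi)-\sum_{k\in\mathcal{O}\setminus\{TR\}}\Theta_k(\boldsymbol f^{nc})&\text{otherwise,}\end{cases}\qquad \Phi_k=\Theta_k(\boldsymbol f^{nc})+\Big(\frac{\delta}{|\mathcal{O}|}\Big)^+\quad\forall k\in\mathcal{O}\setminus\{TR\},$$ where $y^+=\max\{y,0\}$. Then: (a) The MOD operator(s) will enter the pricing alliance with payment rule $\Phi$; that is, $\Phi_k\ge\Theta_k(\boldsymbol f^{nc})$ for every $k\in\mathcal{O}\setminus\{TR\}$.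 (b) When $\delta\ge 0$, the mechanism $\Phi$ satisfies Pareto efficiency, symmetry, the core property, scale invariance, and independence of irrelevant alternatives. (c) If $\pi^{PR}>0$, $\pi^{PX}=0$ and $\pi^{VM}=0$, then $\delta\ge 0$. If $\pi^{PR}=0$ and $\pi^{PX}+\pi^{VM}>0$, with $c_k=0$ for each $k\in\mathcal{O}$, then $\delta<0$.
   Context: **Data.** Finite sets: operators $\mathcal{O}$, consisting of one transit operator $TR$ and the Mobility-on-Demand (MOD) operator(s) $\mathcal{O}\setminus\{TR\}\ne\emptyset$; routes $\mathcal{R}$; discount activation categories $\mathcal{A}$; passenger types $\mathcal{N}$; time intervals $\mathcal{T}$. Route $r$ is served by operators $\mathcal{O}_r\subseteq\mathcal{O}$; $\Delta_{rk}\ge 0$ is the distance of route $r$ covered by operator $k$; $c_k\ge 0$ is operator $k$'s marginal cost per unit distance per passenger. $\mathcal{R}^D\subseteq\mathcal{R}$ (discount-eligible routes) is partitioned into disjoint sets $\mathcal{R}_a^D$, $a\in\mathcal{A}$. Type $i$ has route options $\mathcal{R}_i\subseteq\mathcal{R}$; $N_{it}>0$ is the number of passengers of type $i$ at time $t$; $u_{irt},u_{i0t}\in\mathbb{R}$ are the non-monetary utility of route $r$ and the utility of the outside option (driving); $\alpha_i<0$ is the utility per unit price; $\Delta_i^0>0$ is the driving distance under the outside option. Weights $\pi^{PX},\pi^{PR},\pi^{VM}\ge 0$. Bounds $B,M>0$ with $c_k\le M$, and $0\le L\le 1$. Each MOD operator serves at least one route that belongs to some $\mathcal{R}_i$. **Fares,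 prices, shares.** $\mathcal{F}=\{\boldsymbol f=(\boldsymbol\beta,\boldsymbol\mu):0\le\beta_k\le B,\ c_k\le\mu_k\le M\ \forall k\in\mathcal{O}\}$ and $\mathcal{L}=[0,L]$. Given $\boldsymbol f\in\mathcal{F}$, $\Lambda\in\mathcal{L}$, $\boldsymbol x\in\{0,1\}^{\mathcal{A}}$, prices are $p_r=\sum_{k\in\mathcal{O}_r}(\beta_k+\mu_k\Delta_{rk})$ for $r\in\mathcal{R}\setminus\mathcal{R}^D$ and $p_r=(1-\Lambda x_a)\sum_{k\in\mathcal{O}_r}(\beta_k+\mu_k\Delta_{rk})$ for $r\in\mathcal{R}_a^D$; market shares are $s_{irt}=e^{u_{irt}+\alpha_ip_r}/D_{it}$ for $r\in\mathcal{R}_i$ and $s_{i0t}=e^{u_{i0t}}/D_{it}$, where $D_{it}=e^{u_{i0t}}+\sum_{q\in\mathcal{R}_i}e^{u_{iqt}+\alpha_ip_q}$. The alliance objective is $$\sum_{t\in\mathcal{T}}\sum_{i\in\mathcal{N}}N_{it}\Big(\pi^{PX}\big(u_{i0t}+\sum_{r\in\mathcal{R}_i}(u_{irt}+\alpha_ip_r)\big)+\pi^{PR}\sum_{r\in\mathcal{R}_i}\big(p_r-\sum_{k\in\mathcal{O}_r}c_k\Delta_{rk}\big)s_{irt}-\pi^{VM}\Delta_i^0s_{i0t}\Big).$$ **Allied regime.** $(\boldsymbol f^a,\Lambda^a)$, together with discount activations $\boldsymbol x^a$, maximizes the alliance objective over $\boldsymbol f\in\mathcal{F}$, $\Lambda\in\mathcal{L}$,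 $\boldsymbol x\in\{0,1\}^{\mathcal{A}}$. $\Theta(\boldsymbol f^a,\Lambda^a;\boldsymbol\pi)=\sum_{t}\sum_{i}N_{it}\sum_{r\in\mathcal{R}_i}(p_r-\sum_{k\in\mathcal{O}_r}c_k\Delta_{rk})s_{irt}$ evaluated at this optimum. **Non-cooperative regime.** No discounts are offered ($\Lambda=0$), and each operator $k$ chooses its own $(\beta_k,\mu_k)\in[0,B]\times[c_k,M]$. The profit of operator $k$ is $\Theta_k(\boldsymbol f)=\sum_t\sum_iN_{it}\sum_{r\in\mathcal{R}_i:\,k\in\mathcal{O}_r}(\beta_k+(\mu_k-c_k)\Delta_{rk})s_{irt}$, with shares computed at the undiscounted prices. $\boldsymbol f^{nc}\in\mathcal{F}$ is a Nash equilibrium of the game in which each MOD operator maximizes its own profit $\Theta_k$ and the transit operator maximizes the alliance objective (with the same weights $\boldsymbol\pi$). **Participation.** An MOD operator $k$ enters the alliance if and only if its allocated profit is at least its non-cooperative profit $\Theta_k(\boldsymbol f^{nc})$. **Meaning of the properties in (b).** An allocation problem is a pair $(\boldsymbol d,p)$ with disagreement outcome $\boldsymbol d\in\mathbb{R}_+^{\mathcal{O}}$ (playing the role of $(\Theta_k(\boldsymbol f^{nc}))_k$) and total allied profit $p\ge\sum_kd_k$ (playing the role of $\Theta(\boldsymbol f^a,\Lambda^a;\boldsymbol\pi)$, so that $\delta=p-\sum_kd_k\ge 0$). Its set of allocations is $\mathcal{X}(\boldsymbol d,p)=\{\boldsymbol a\in\mathbb{R}^{\mathcal{O}}:a_k\ge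 d_k\ \forall k,\ \sum_ka_k\le p\}$. On these problems $\Phi$ is the map $\Phi_k(\boldsymbol d,p)=d_k+\frac{1}{|\mathcal{O}|}\big(p-\sum_ld_l\big)$, $k\in\mathcal{O}$. For all such problems: - Pareto efficiency: $\Phi(\boldsymbol d,p)\in\mathcal{X}(\boldsymbol d,p)$, and no $\boldsymbol a\in\mathcal{X}(\boldsymbol d,p)$ satisfies $a_k\ge\Phi_k(\boldsymbol d,p)$ for all $k$ with strict inequality for some $k$. - Symmetry: if $d_j=d_k$ then $\Phi_j(\boldsymbol d,p)=\Phi_k(\boldsymbol d,p)$. - Core property: the full profit is distributed, $\sum_k\Phi_k(\boldsymbol d,p)=p$, and no group of operators gains by reverting to the non-cooperative outcome: $\sum_{k\in S}\Phi_k(\boldsymbol d,p)\ge\sum_{k\in S}d_k$ for all $S\subseteq\mathcal{O}$ (in particular $\Phi_k(\boldsymbol d,p)\ge d_k$ for each $k$). - Scale invariance: if $A(\boldsymbol a)_k=\lambda_ka_k+\tau_k$ with $\lambda_k>0$, $\tau_k\in\mathbb{R}$, and $(\boldsymbol d',p')$ is an allocation problem with $\boldsymbol d'=A(\boldsymbol d)$ and $\mathcal{X}(\boldsymbol d',p')=A(\mathcal{X}(\boldsymbol d,p))$, then $\Phi(\boldsymbol d',p')=A(\Phi(\boldsymbol d,p))$. - Independence of irrelevant alternatives: if $\mathcal{X}(\boldsymbol d,p')\subseteq\mathcal{X}(\boldsymbol d,p)$ and $\Phi(\boldsymbol d,p)\in\mathcal{X}(\boldsymbol d,p')$, then $\Phi(\boldsymbol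 d,p')=\Phi(\boldsymbol d,p)$. *)

theory Defs
  imports Complex_Main "HOL-Library.Disjoint_Sets" "HOL-Library.Cardinality"
begin

section \<open>The pricing model\<close>

text \<open>
  Operators, routes, passenger types and time intervals are finite types. None of these sets
  can be empty in the model: there are at least two operators, every Mobility-on-Demand operator
  serves a route option of some passenger type, and a model without time intervals is void.
  Discount categories are an explicit finite set, which may be empty.
\<close>

record ('o, 'r, 'a, 'n, 't) market =
  transit :: 'o
  operators_of :: "'r \<Rightarrow> 'o set"
  distance :: "'r \<Rightarrow> 'o \<Rightarrow> real"
  unit_cost :: "'o \<Rightarrow> real"
  categories :: "'a set"
  discount_routes :: "'a \<Rightarrow> 'r set"
  routes_of :: "'n \<Rightarrow> 'r set"
  passengers :: "'n \<Rightarrow> 't \<Rightarrow> real"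
  utility :: "'n \<Rightarrow> 'r \<Rightarrow> 't \<Rightarrow> real"
  outside_utility :: "'n \<Rightarrow> 't \<Rightarrow> real"
  price_coeff :: "'n \<Rightarrow> real"
  driving_distance :: "'n \<Rightarrow> real"
  base_max :: real        \<comment> \<open>\<open>B\<close>\<close>
  rate_max :: real        \<comment> \<open>\<open>M\<close>\<close>
  discount_max :: real    \<comment> \<open>\<open>L\<close>\<close>

definition valid_market ::
    "('o::finite, 'r::finite, 'a, 'n::finite, 't::finite) market \<Rightarrow> bool" where
  "valid_market m \<longleftrightarrow>
     UNIV - {transit m} \<noteq> {} \<and>
     finite (categories m) \<and>
     disjoint_family_on (discount_routes m) (categories m) \<and>
     (\<forall>r k. 0 \<le> distance m r k) \<and>
     (\<forall>k. 0 \<le> unit_cost m k \<and> unit_cost m k \<le> rate_max m) \<and>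
     (\<forall>i t. 0 < passengers m i t) \<and>
     (\<forall>i. price_coeff m i < 0) \<and>
     (\<forall>i. 0 < driving_distance m i) \<and>
     0 < base_max m \<and> 0 < rate_max m \<and>
     0 \<le> discount_max m \<and> discount_max m \<le> 1 \<and>
     (\<forall>k\<in>UNIV - {transit m}. \<exists>i. \<exists>r\<in>routes_of m i. k \<in> operators_of m r)"

text \<open>Fare parameters are pairs \<open>(\<beta>, \<mu>)\<close>.\<close>

type_synonym 'o fares = "('o \<Rightarrow> real) \<times> ('o \<Rightarrow> real)"

definition operator_fares ::
    "('o, 'r, 'a, 'n, 't) market \<Rightarrow> 'o \<Rightarrow> (real \<times> real) set" where
  "operator_fares m k = {0..base_max m} \<times> {unit_cost m k..rate_max m}"

definition fare_set :: "('o, 'r, 'a, 'n, 't) market \<Rightarrow> 'o fares set" where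
  "fare_set m = {f. \<forall>k. (fst f k, snd f k) \<in> operator_fares m k}"

definition multiplier_set :: "('o, 'r, 'a, 'n, 't) market \<Rightarrow> real set" where
  "multiplier_set m = {0..discount_max m}"

text \<open>Values of an activation outside \<open>categories m\<close> are irrelevant.\<close>

definition activation_set :: "('o, 'r, 'a, 'n, 't) market \<Rightarrow> ('a \<Rightarrow> real) set" where
  "activation_set m = {x. \<forall>a\<in>categories m. x a \<in> {0, 1}}"

definition full_price :: "('o, 'r, 'a, 'n, 't) market \<Rightarrow> 'o fares \<Rightarrow> 'r \<Rightarrow> real" where
  "full_price m f r = (\<Sum>k\<in>operators_of m r. fst f k + snd f k * distance m r k)"

text \<open>
  The categories' route sets are disjoint in a valid market, so an eligible route determines
  its category.
\<close>

definition price ::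
    "('o, 'r, 'a, 'n, 't) market \<Rightarrow> 'o fares \<Rightarrow> real \<Rightarrow> ('a \<Rightarrow> real) \<Rightarrow> 'r \<Rightarrow> real" where
  "price m f \<Lambda> x r =
     (if r \<in> (\<Union>a\<in>categories m. discount_routes m a)
      then (1 - \<Lambda> * x (THE a. a \<in> categories m \<and> r \<in> discount_routes m a)) * full_price m f r
      else full_price m f r)"

text \<open>The quantities below depend on the fares only through the resulting route prices \<open>p\<close>.\<close>

definition choice_weight ::
    "('o, 'r, 'a, 'n, 't) market \<Rightarrow> ('r \<Rightarrow> real) \<Rightarrow> 'n \<Rightarrow> 't \<Rightarrow> real" where
  "choice_weight m p i t =
     exp (outside_utility m i t) +
     (\<Sum>q\<in>routes_of m i. exp (utility m i q t + price_coeff m i * p q))"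

definition share ::
    "('o, 'r, 'a, 'n, 't) market \<Rightarrow> ('r \<Rightarrow> real) \<Rightarrow> 'n \<Rightarrow> 'r \<Rightarrow> 't \<Rightarrow> real" where
  "share m p i r t = exp (utility m i r t + price_coeff m i * p r) / choice_weight m p i t"

definition outside_share ::
    "('o, 'r, 'a, 'n, 't) market \<Rightarrow> ('r \<Rightarrow> real) \<Rightarrow> 'n \<Rightarrow> 't \<Rightarrow> real" where
  "outside_share m p i t = exp (outside_utility m i t) / choice_weight m p i t"

definition alliance_objective ::
    "('o, 'r, 'a, 'n::finite, 't::finite) market \<Rightarrow> real \<Rightarrow> real \<Rightarrow> real \<Rightarrow> ('r \<Rightarrow> real) \<Rightarrow> real" where
  "alliance_objective m \<pi>PX \<pi>PR \<pi>VM p =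
     (\<Sum>t\<in>UNIV. \<Sum>i\<in>UNIV. passengers m i t *
        (\<pi>PX * (outside_utility m i t +
                 (\<Sum>r\<in>routes_of m i. utility m i r t + price_coeff m i * p r)) +
         \<pi>PR * (\<Sum>r\<in>routes_of m i.
                  (p r - (\<Sum>k\<in>operators_of m r. unit_cost m k * distance m r k)) * share m p i r t) -
         \<pi>VM * driving_distance m i * outside_share m p i t))"

definition alliance_profit ::
    "('o, 'r, 'a, 'n::finite, 't::finite) market \<Rightarrow> ('r \<Rightarrow> real) \<Rightarrow> real" where
  "alliance_profit m p =
     (\<Sum>t\<in>UNIV. \<Sum>i\<in>UNIV. passengers m i t *
        (\<Sum>r\<in>routes_of m i.
           (p r - (\<Sum>k\<in>operators_of m r. unit_cost m k * distance m r k)) * share m p i r t))"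

definition allied_optimum ::
    "('o, 'r, 'a, 'n::finite, 't::finite) market \<Rightarrow> real \<Rightarrow> real \<Rightarrow> real \<Rightarrow>
     'o fares \<Rightarrow> real \<Rightarrow> ('a \<Rightarrow> real) \<Rightarrow> bool" where
  "allied_optimum m \<pi>PX \<pi>PR \<pi>VM f \<Lambda> x \<longleftrightarrow>
     is_arg_max (\<lambda>(f, \<Lambda>, x). alliance_objective m \<pi>PX \<pi>PR \<pi>VM (price m f \<Lambda> x))
       (\<lambda>(f, \<Lambda>, x). f \<in> fare_set m \<and> \<Lambda> \<in> multiplier_set m \<and> x \<in> activation_set m)
       (f, \<Lambda>, x)"

definition operator_profit ::
    "('o, 'r, 'a, 'n::finite, 't::finite) market \<Rightarrow> 'o fares \<Rightarrow> 'o \<Rightarrow> real" where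
  "operator_profit m f k =
     (\<Sum>t\<in>UNIV. \<Sum>i\<in>UNIV. passengers m i t *
        (\<Sum>r\<in>{r \<in> routes_of m i. k \<in> operators_of m r}.
           (fst f k + (snd f k - unit_cost m k) * distance m r k) * share m (full_price m f) i r t))"

definition noncoop_payoff ::
    "('o, 'r, 'a, 'n::finite, 't::finite) market \<Rightarrow> real \<Rightarrow> real \<Rightarrow> real \<Rightarrow>
     'o fares \<Rightarrow> 'o \<Rightarrow> real" where
  "noncoop_payoff m \<pi>PX \<pi>PR \<pi>VM f k =
     (if k = transit m then alliance_objective m \<pi>PX \<pi>PR \<pi>VM (full_price m f)
      else operator_profit m f k)"

definition noncoop_equilibrium ::
    "('o, 'r, 'a, 'n::finite, 't::finite) market \<Rightarrow> real \<Rightarrow> real \<Rightarrow> real \<Rightarrow> 'o fares \<Rightarrow> bool" where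
  "noncoop_equilibrium m \<pi>PX \<pi>PR \<pi>VM f \<longleftrightarrow>
     f \<in> fare_set m \<and>
     (\<forall>k. is_arg_max
            (\<lambda>(b, u). noncoop_payoff m \<pi>PX \<pi>PR \<pi>VM ((fst f)(k := b), (snd f)(k := u)) k)
            (\<lambda>(b, u). (b, u) \<in> operator_fares m k)
            (fst f k, snd f k))"


section \<open>Profit allocation\<close>

text \<open>
  A mechanism \<open>\<Phi>\<close> maps a disagreement outcome \<open>d\<close> and a total profit \<open>p\<close> to the allocations
  of the operators. In \<open>payment_rule\<close>, \<open>tr\<close> is the transit operator.
\<close>

type_synonym 'o mechanism = "('o \<Rightarrow> real) \<Rightarrow> real \<Rightarrow> 'o \<Rightarrow> real"

definition payment_rule :: "'o::finite \<Rightarrow> 'o mechanism" where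
  "payment_rule tr d p k =
     (let \<delta> = p - (\<Sum>l\<in>UNIV. d l) in
      if k = tr then
        (if \<delta> \<ge> 0 then d tr + \<delta> / real CARD('o) else p - (\<Sum>l\<in>UNIV - {tr}. d l))
      else d k + max (\<delta> / real CARD('o)) 0)"

definition allocation_problem :: "('o::finite \<Rightarrow> real) \<Rightarrow> real \<Rightarrow> bool" where
  "allocation_problem d p \<longleftrightarrow> (\<forall>k. 0 \<le> d k) \<and> (\<Sum>k\<in>UNIV. d k) \<le> p"

definition allocations :: "('o::finite \<Rightarrow> real) \<Rightarrow> real \<Rightarrow> ('o \<Rightarrow> real) set" where
  "allocations d p = {a. (\<forall>k. d k \<le> a k) \<and> (\<Sum>k\<in>UNIV. a k) \<le> p}"

lemma payment_rule_allocation_problem: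
  fixes d :: "'o::finite \<Rightarrow> real"
  assumes "allocation_problem d p"
  shows "payment_rule tr d p k = d k + (1 / real CARD('o)) * (p - (\<Sum>l\<in>UNIV. d l))"
  using assms by (auto simp: payment_rule_def allocation_problem_def Let_def max_def divide_le_0_iff)

definition pareto_efficient :: "'o::finite mechanism \<Rightarrow> bool" where
  "pareto_efficient \<Phi> \<longleftrightarrow>
     (\<forall>d p. allocation_problem d p \<longrightarrow>
        \<Phi> d p \<in> allocations d p \<and>
        \<not> (\<exists>a\<in>allocations d p. (\<forall>k. \<Phi> d p k \<le> a k) \<and> (\<exists>k. \<Phi> d p k < a k)))"

definition symmetric_mechanism :: "'o::finite mechanism \<Rightarrow> bool" where
  "symmetric_mechanism \<Phi> \<longleftrightarrow>
     (\<forall>d p. allocation_problem d p \<longrightarrow> (\<forall>j k. d j = d k \<longrightarrow> \<Phi> d p j = \<Phi> d p k))"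

definition core_property :: "'o::finite mechanism \<Rightarrow> bool" where
  "core_property \<Phi> \<longleftrightarrow>
     (\<forall>d p. allocation_problem d p \<longrightarrow>
        (\<Sum>k\<in>UNIV. \<Phi> d p k) = p \<and> (\<forall>S. (\<Sum>k\<in>S. d k) \<le> (\<Sum>k\<in>S. \<Phi> d p k)))"

definition scale_invariant :: "'o::finite mechanism \<Rightarrow> bool" where
  "scale_invariant \<Phi> \<longleftrightarrow>
     (\<forall>d p d' p' lam tau.
        let A = (\<lambda>a k. lam k * a k + tau k) in
        allocation_problem d p \<longrightarrow> allocation_problem d' p' \<longrightarrow>
        (\<forall>k. 0 < lam k) \<longrightarrow> d' = A d \<longrightarrow> allocations d' p' = A ` allocations d p \<longrightarrow>
        \<Phi> d' p' = A (\<Phi> d p))"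

definition independent_of_irrelevant_alternatives :: "'o::finite mechanism \<Rightarrow> bool" where
  "independent_of_irrelevant_alternatives \<Phi> \<longleftrightarrow>
     (\<forall>d p p'. allocation_problem d p \<longrightarrow> allocation_problem d p' \<longrightarrow>
        allocations d p' \<subseteq> allocations d p \<longrightarrow> \<Phi> d p \<in> allocations d p' \<longrightarrow>
        \<Phi> d p' = \<Phi> d p)"

end

theory Submission
  imports Defs
begin

text \<open>
  Without discounts the alliance profit at common fares is the sum of the operators' profits, and
  these fares are feasible for the alliance; so an alliance that maximizes profit cannot lose.
  If transit puts no weight on profit, the alliance objective is strictly decreasing in the prices
  of the route options, so with zero costs the allied optimum is free travel with zero profit,
  whereas in equilibrium every Mobility-on-Demand operator earns at least what its maximal
  fares would give it, which is positive.
\<close>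

section \<open>Properties of the payment rule\<close>

lemma payment_rule_sum:
  fixes d :: "'o::finite \<Rightarrow> real"
  assumes "allocation_problem d p"
  shows "(\<Sum>k\<in>UNIV. payment_rule tr d p k) = p"
  by (simp add: payment_rule_allocation_problem[OF assms] sum.distrib)

lemma payment_rule_ge:
  fixes d :: "'o::finite \<Rightarrow> real"
  assumes "allocation_problem d p"
  shows "d k \<le> payment_rule tr d p k"
  using assms by (simp add: payment_rule_allocation_problem[OF assms] allocation_problem_def)

lemma payment_rule_allocation:
  assumes "allocation_problem d p"
  shows "payment_rule tr d p \<in> allocations d p"
  using payment_rule_sum[OF assms] payment_rule_ge[OF assms] by (simp add: allocations_def)

text \<open>Along the direction of operator k the largest feasible gain is the surplus itself, so
  the surplus can be read off from the allocation set.\<close>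

lemma single_gain_allocation_iff:
  fixes d :: "'o::finite \<Rightarrow> real"
  shows "(\<lambda>j. d j + (if j = k then e else 0)) \<in> allocations d p
           \<longleftrightarrow> 0 \<le> e \<and> (\<Sum>j\<in>UNIV. d j) + e \<le> p"
  by (auto simp: allocations_def sum.distrib)

lemma pareto_efficient_payment_rule: "pareto_efficient (payment_rule (tr :: 'o::finite))"
  unfolding pareto_efficient_def
proof (intro allI impI conjI)
  fix d :: "'o \<Rightarrow> real" and p :: real
  assume P: "allocation_problem d p"
  show "payment_rule tr d p \<in> allocations d p"
    by (rule payment_rule_allocation[OF P])
  show "\<not> (\<exists>a\<in>allocations d p. (\<forall>k. payment_rule tr d p k \<le> a k) \<and> (\<exists>k. payment_rule tr d p k < a k))"
  proof
    assume "\<exists>a\<in>allocations d p. (\<forall>k. payment_rule tr d p k \<le> a k) \<and> (\<exists>k. payment_rule tr d p k < a k)"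
    then obtain a where a: "a \<in> allocations d p" "\<forall>k. payment_rule tr d p k \<le> a k"
        "\<exists>k. payment_rule tr d p k < a k"
      by blast
    \<comment> \<open>The rule already distributes all of p, so a dominating allocation would have
      to exceed the budget.\<close>
    then have "(\<Sum>k\<in>UNIV. payment_rule tr d p k) < (\<Sum>k\<in>UNIV. a k)"
      by (intro sum_strict_mono_ex1) auto
    with a(1) payment_rule_sum[OF P] show False
      by (simp add: allocations_def)
  qed
qed

lemma symmetric_payment_rule: "symmetric_mechanism (payment_rule tr)"
  by (simp add: symmetric_mechanism_def payment_rule_allocation_problem)

lemma core_property_payment_rule: "core_property (payment_rule tr)"
  by (auto simp: core_property_def payment_rule_sum intro: sum_mono payment_rule_ge)

text \<open>
  Comparing the allocations that give the whole surplus to one operator shows that an affine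
  map between allocation sets multiplies the surplus by each of its slopes.
\<close>

lemma affine_image_surplus:
  fixes d d' lam tau :: "'o::finite \<Rightarrow> real"
  defines "A \<equiv> \<lambda>a k. lam k * a k + tau k"
  assumes P: "allocation_problem d p" and P': "allocation_problem d' p'"
    and lam: "\<forall>k. 0 < lam k" and d': "d' = A d"
    and image: "allocations d' p' = A ` allocations d p"
  shows "p' - (\<Sum>l\<in>UNIV. d' l) = lam k * (p - (\<Sum>l\<in>UNIV. d l))"
proof -
  let ?s = "\<lambda>(d :: 'o \<Rightarrow> real) e j. d j + (if j = k then e else 0)"
  \<comment> \<open>\<open>A\<close> maps d to d', so a gain e of operator k over d becomes a gain
    \<open>lam k * e\<close> over d'.\<close>
  have A_s: "A (?s d e) = ?s d' (lam k * e)" for e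
    by (auto simp: A_def d' algebra_simps)
  \<comment> \<open>Injectivity lets membership in the image be pulled back to membership in the
    original set, which gives both directions of \<open>mem\<close>.\<close>
  have inj: "inj A"
    using lam by (intro injI) (simp add: A_def fun_eq_iff less_imp_neq[symmetric])
  have mem: "?s d e \<in> allocations d p \<longleftrightarrow> ?s d' (lam k * e) \<in> allocations d' p'" for e
    using inj_image_mem_iff[OF inj, of "?s d e" "allocations d p"] by (simp only: image A_s)
  have lk: "0 < lam k"
    using lam by simp
  have *: "(0 \<le> e \<and> (\<Sum>l\<in>UNIV. d l) + e \<le> p)
      \<longleftrightarrow> (0 \<le> lam k * e \<and> (\<Sum>l\<in>UNIV. d' l) + lam k * e \<le> p')" for e
    using mem[of e] by (simp only: single_gain_allocation_iff)
  \<comment> \<open>Each full surplus is a feasible gain in its own problem; carrying it over to the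
    other one gives the two inequalities.\<close>
  have "lam k * (p - (\<Sum>l\<in>UNIV. d l)) \<le> p' - (\<Sum>l\<in>UNIV. d' l)"
    using *[of "p - (\<Sum>l\<in>UNIV. d l)"] P by (simp add: allocation_problem_def)
  moreover have "(p' - (\<Sum>l\<in>UNIV. d' l)) / lam k \<le> p - (\<Sum>l\<in>UNIV. d l)"
    using *[of "(p' - (\<Sum>l\<in>UNIV. d' l)) / lam k"] P' lk by (simp add: allocation_problem_def)
  ultimately show ?thesis
    using lk by (simp add: pos_divide_le_eq mult.commute)
qed

text \<open>The surplus relation holds for every k, so the slopes must agree unless the surplus is
  zero. This is why an equal split of profit survives operator-wise rescaling.\<close>

lemma scale_invariant_payment_rule: "scale_invariant (payment_rule (tr :: 'o::finite))"
  unfolding scale_invariant_def Let_def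
proof (intro allI impI)
  fix d d' lam tau :: "'o \<Rightarrow> real" and p p' :: real
  assume P: "allocation_problem d p" and P': "allocation_problem d' p'"
    and lam: "\<forall>k. 0 < lam k" and d': "d' = (\<lambda>k. lam k * d k + tau k)"
    and image: "allocations d' p' = (\<lambda>a k. lam k * a k + tau k) ` allocations d p"
  note surplus = affine_image_surplus[OF P P' lam d' image]
  show "payment_rule tr d' p' = (\<lambda>k. lam k * payment_rule tr d p k + tau k)"
  proof
    fix k
    have "payment_rule tr d' p' k
        = d' k + (1 / real CARD('o)) * (lam k * (p - (\<Sum>l\<in>UNIV. d l)))"
      by (simp only: payment_rule_allocation_problem[OF P'] surplus[of k])
    also have "\<dots> = lam k * payment_rule tr d p k + tau k"
      unfolding payment_rule_allocation_problem[OF P] d' by (simp add: distrib_left)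
    finally show "payment_rule tr d' p' k = lam k * payment_rule tr d p k + tau k" .
  qed
qed

text \<open>The two set conditions force p' = p: the old outcome fits into the new budget, and by
  inclusion the new outcome fits into the old one, while each outcome spends its budget
  fully.\<close>

lemma independent_payment_rule:
  "independent_of_irrelevant_alternatives (payment_rule (tr :: 'o::finite))"
  unfolding independent_of_irrelevant_alternatives_def
proof (intro allI impI)
  fix d :: "'o \<Rightarrow> real" and p p' :: real
  assume P: "allocation_problem d p" and P': "allocation_problem d p'"
    and sub: "allocations d p' \<subseteq> allocations d p"
    and mem: "payment_rule tr d p \<in> allocations d p'"
  have "p \<le> p'"
    using mem payment_rule_sum[OF P, of tr] by (simp add: allocations_def)
  moreover have "p' \<le> p"
    using subsetD[OF sub payment_rule_allocation[OF P', of tr]] payment_rule_sum[OF P', of tr]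
    by (simp add: allocations_def)
  ultimately show "payment_rule tr d p' = payment_rule tr d p"
    by simp
qed


section \<open>Shares and profits\<close>

lemma choice_weight_pos: "0 < choice_weight m p i t"
  unfolding choice_weight_def by (intro add_pos_nonneg sum_nonneg) auto

lemma share_pos: "0 < share m p i r t"
  by (simp add: share_def choice_weight_pos)

lemma margin_nonneg:
  assumes "valid_market m" and "(b, u) \<in> operator_fares m k"
  shows "0 \<le> b + (u - unit_cost m k) * distance m r k"
  using assms by (auto simp: valid_market_def operator_fares_def)

lemma operator_profit_nonneg:
  assumes "valid_market m" and "(fst f k, snd f k) \<in> operator_fares m k"
  shows "0 \<le> operator_profit m f k"
  unfolding operator_profit_def using assms
  by (intro sum_nonneg mult_nonneg_nonneg margin_nonneg less_imp_le[OF share_pos])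
    (auto simp: valid_market_def less_imp_le)

text \<open>A positive base fare keeps every margin positive even if the rate only covers cost or
  the distance is zero, and logit shares never vanish.\<close>

lemma operator_profit_pos:
  fixes m :: "('o::finite, 'r::finite, 'a, 'n::finite, 't::finite) market"
  assumes m: "valid_market m" and f: "(fst f k, snd f k) \<in> operator_fares m k"
    and base: "0 < fst f k" and k: "k \<noteq> transit m"
  shows "0 < operator_profit m f k"
proof -
  let ?g = "\<lambda>i r t. (fst f k + (snd f k - unit_cost m k) * distance m r k)
                     * share m (full_price m f) i r t"
  let ?R = "\<lambda>i. {r \<in> routes_of m i. k \<in> operators_of m r}"
  let ?h = "\<lambda>t i. passengers m i t * (\<Sum>r\<in>?R i. ?g i r t)"
  \<comment> \<open>Only for Mobility-on-Demand operators does the market guarantee a served route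
    option; \<open>k\<close> enters here.\<close>
  obtain i r where ir: "r \<in> ?R i"
    using m k unfolding valid_market_def by blast
  have N: "0 < passengers m j t" for j t
    using m by (simp add: valid_market_def)
  have margin: "0 < fst f k + (snd f k - unit_cost m k) * distance m q k" for q
    using m f base by (intro add_pos_nonneg) (auto simp: valid_market_def operator_fares_def)
  have g: "0 < ?g j q t" for j q t
    by (intro mult_pos_pos margin share_pos)
  have h: "0 \<le> ?h t j" for t j
    by (intro mult_nonneg_nonneg sum_nonneg less_imp_le[OF N] less_imp_le[OF g])
  have hi: "0 < ?h t i" for t
    using ir g by (intro mult_pos_pos[OF N] sum_pos) auto
  have "0 < (\<Sum>j\<in>UNIV. ?h t j)" for t
    using hi h by (intro sum_pos2[where i = i]) auto
  then show ?thesis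
    unfolding operator_profit_def by (rule sum_pos[rotated 2]) simp_all
qed

text \<open>Each route margin splits into the margins of its serving operators; exchanging sums then
  collects the terms operator by operator.\<close>

lemma alliance_profit_full_price:
  fixes m :: "('o::finite, 'r::finite, 'a, 'n::finite, 't::finite) market"
  shows "alliance_profit m (full_price m f) = (\<Sum>k\<in>UNIV. operator_profit m f k)"
proof -
  let ?g = "\<lambda>i t r k. (fst f k + (snd f k - unit_cost m k) * distance m r k)
                       * share m (full_price m f) i r t"
  let ?R = "\<lambda>i k. {r \<in> routes_of m i. k \<in> operators_of m r}"
  have "(full_price m f r - (\<Sum>k\<in>operators_of m r. unit_cost m k * distance m r k))
          * share m (full_price m f) i r t = (\<Sum>k\<in>operators_of m r. ?g i t r k)" for i r t
    unfolding full_price_def sum_subtractf[symmetric] sum_distrib_right[symmetric]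
    by (simp add: algebra_simps)
  then have "(\<Sum>r\<in>routes_of m i.
        (full_price m f r - (\<Sum>k\<in>operators_of m r. unit_cost m k * distance m r k))
          * share m (full_price m f) i r t)
      = (\<Sum>r\<in>routes_of m i. \<Sum>k\<in>{k\<in>UNIV. k \<in> operators_of m r}. ?g i t r k)" for i t
    by simp
  also have "\<dots> i t = (\<Sum>k\<in>UNIV. \<Sum>r\<in>?R i k. ?g i t r k)" for i t
    by (rule sum.swap_restrict) auto
  finally have "alliance_profit m (full_price m f)
      = (\<Sum>t\<in>UNIV. \<Sum>i\<in>UNIV. \<Sum>k\<in>UNIV. passengers m i t * (\<Sum>r\<in>?R i k. ?g i t r k))"
    by (simp add: alliance_profit_def sum_distrib_left)
  also have "\<dots> = (\<Sum>t\<in>UNIV. \<Sum>k\<in>UNIV. \<Sum>i\<in>UNIV. passengers m i t * (\<Sum>r\<in>?R i k. ?g i t r k))"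
    by (intro sum.cong refl sum.swap)
  also have "\<dots> = (\<Sum>k\<in>UNIV. \<Sum>t\<in>UNIV. \<Sum>i\<in>UNIV. passengers m i t * (\<Sum>r\<in>?R i k. ?g i t r k))"
    by (rule sum.swap)
  finally show ?thesis
    by (simp add: operator_profit_def)
qed


section \<open>Prices and the alliance objective\<close>

lemma price_no_discount: "price m f 0 x = full_price m f"
  by (simp add: price_def fun_eq_iff)

lemma full_price_nonneg:
  assumes "valid_market m" and "f \<in> fare_set m"
  shows "0 \<le> full_price m f r"
  unfolding full_price_def
proof (intro sum_nonneg add_nonneg_nonneg mult_nonneg_nonneg)
  fix k
  show "0 \<le> fst f k" "0 \<le> distance m r k"
    using assms by (auto simp: valid_market_def fare_set_def operator_fares_def)
  have "0 \<le> unit_cost m k" "unit_cost m k \<le> snd f k"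
    using assms by (auto simp: valid_market_def fare_set_def operator_fares_def)
  then show "0 \<le> snd f k"
    by (rule order_trans)
qed

lemma price_nonneg:
  assumes m: "valid_market m" and f: "f \<in> fare_set m"
    and l: "\<Lambda> \<in> multiplier_set m" and x: "x \<in> activation_set m"
  shows "0 \<le> price m f \<Lambda> x r"
proof (cases "r \<in> (\<Union>a\<in>categories m. discount_routes m a)")
  case True
  let ?a = "THE a. a \<in> categories m \<and> r \<in> discount_routes m a"
  from True obtain a where a: "a \<in> categories m" "r \<in> discount_routes m a"
    by blast
  \<comment> \<open>Disjointness of the categories makes the description unique.\<close>
  have "?a = a"
    using m a by (intro the_equality) (auto simp: valid_market_def disjoint_family_on_def)
  with x a have "x ?a \<in> {0, 1}"
    by (auto simp: activation_set_def)
  moreover have "\<Lambda> \<le> 1"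
    using m l by (auto simp: valid_market_def multiplier_set_def)
  ultimately have "0 \<le> 1 - \<Lambda> * x ?a"
    by auto
  with full_price_nonneg[OF m f, of r] show ?thesis
    unfolding price_def by auto
next
  case False
  then show ?thesis
    using full_price_nonneg[OF m f, of r] by (simp add: price_def)
qed

text \<open>Prices enter only the denominator: since \<open>price_coeff\<close> is negative, higher
  prices shrink every route's weight.\<close>

lemma outside_share_mono:
  fixes m :: "('o, 'r::finite, 'a, 'n, 't) market"
  assumes "price_coeff m i < 0" and "\<And>r. p r \<le> q r"
  shows "outside_share m p i t \<le> outside_share m q i t"
  unfolding outside_share_def
proof (rule divide_left_mono)
  show "choice_weight m q i t \<le> choice_weight m p i t"
    unfolding choice_weight_def using assms by (intro add_mono sum_mono) (auto intro: mult_left_mono_neg)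
qed (auto intro: mult_pos_pos choice_weight_pos)

lemma outside_share_strict_mono:
  fixes m :: "('o, 'r::finite, 'a, 'n, 't) market"
  assumes "price_coeff m i < 0" and "\<And>r. p r \<le> q r" and "r \<in> routes_of m i" and "p r < q r"
  shows "outside_share m p i t < outside_share m q i t"
  unfolding outside_share_def
proof (rule divide_strict_left_mono)
  show "choice_weight m q i t < choice_weight m p i t"
    unfolding choice_weight_def using assms
    by (intro add_strict_left_mono sum_strict_mono_ex1)
      (auto intro: mult_left_mono_neg mult_strict_left_mono_neg)
qed (auto intro: mult_pos_pos choice_weight_pos)

text \<open>Higher prices lower utility and increase driving. The change for type i is strict in
  whichever of the two terms has positive weight.\<close>

lemma alliance_objective_strict_antimono:
  fixes m :: "('o::finite, 'r::finite, 'a, 'n::finite, 't::finite) market"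
  assumes m: "valid_market m" and PX: "0 \<le> \<pi>PX" and VM: "0 \<le> \<pi>VM" and weights: "0 < \<pi>PX + \<pi>VM"
    and le: "\<And>r. p r \<le> q r" and r: "r \<in> routes_of m i" and less: "p r < q r"
  shows "alliance_objective m \<pi>PX 0 \<pi>VM q < alliance_objective m \<pi>PX 0 \<pi>VM p"
proof -
  let ?U = "\<lambda>p j t. outside_utility m j t
              + (\<Sum>r\<in>routes_of m j. utility m j r t + price_coeff m j * p r)"
  let ?g = "\<lambda>p t j. passengers m j t
              * (\<pi>PX * ?U p j t - \<pi>VM * driving_distance m j * outside_share m p j t)"
  have \<alpha>: "price_coeff m j < 0" and \<Delta>: "0 < driving_distance m j" and N: "0 < passengers m j t" for j t
    using m by (auto simp: valid_market_def)
  have U: "?U q j t \<le> ?U p j t" for j t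
    using \<alpha>[of j] le by (intro add_mono sum_mono) (auto intro: mult_left_mono_neg)
  have Ui: "?U q i t < ?U p i t" for t
    using \<alpha>[of i] le r less by (intro add_strict_left_mono sum_strict_mono_ex1)
      (auto intro: mult_left_mono_neg mult_strict_left_mono_neg)
  have V: "\<pi>VM * driving_distance m j * outside_share m p j t
      \<le> \<pi>VM * driving_distance m j * outside_share m q j t" for j t
    using VM \<Delta>[of j] outside_share_mono[where p = p and q = q, OF \<alpha> le] by (intro mult_left_mono) auto
  have g: "?g q t j \<le> ?g p t j" for t j
    using N PX by (intro mult_left_mono diff_mono U V) (auto intro: less_imp_le)
  have gi: "?g q t i < ?g p t i" for t
  proof (rule mult_strict_left_mono[OF _ N], cases "0 < \<pi>PX")
    case True
    then show "\<pi>PX * ?U q i t - \<pi>VM * driving_distance m i * outside_share m q i t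
        < \<pi>PX * ?U p i t - \<pi>VM * driving_distance m i * outside_share m p i t"
      using mult_strict_left_mono[OF Ui[of t] True] V[of i t] by linarith
  next
    case False
    with weights PX have "\<pi>PX = 0" "0 < \<pi>VM"
      by auto
    then show "\<pi>PX * ?U q i t - \<pi>VM * driving_distance m i * outside_share m q i t
        < \<pi>PX * ?U p i t - \<pi>VM * driving_distance m i * outside_share m p i t"
      using outside_share_strict_mono[where p = p and q = q, OF \<alpha> le r less] \<Delta>[of i] by simp
  qed
  \<comment> \<open>Type i gives strictness at every time, so the sum over the nonempty set of times
    is strict too.\<close>
  have "(\<Sum>j\<in>UNIV. ?g q t j) < (\<Sum>j\<in>UNIV. ?g p t j)" for t
    using g gi by (intro sum_strict_mono_ex1) auto
  then have "(\<Sum>t\<in>UNIV. \<Sum>j\<in>UNIV. ?g q t j) < (\<Sum>t\<in>UNIV. \<Sum>j\<in>UNIV. ?g p t j)"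
    by (rule sum_strict_mono[rotated 2]) simp_all
  then show ?thesis
    by (simp add: alliance_objective_def)
qed

lemma alliance_objective_profit:
  "alliance_objective m 0 \<pi>PR 0 p = \<pi>PR * alliance_profit m p"
  by (simp add: alliance_objective_def alliance_profit_def sum_distrib_left mult_ac)


section \<open>The two regimes\<close>

lemma allied_optimum_feasible:
  assumes "allied_optimum m \<pi>PX \<pi>PR \<pi>VM f \<Lambda> x"
  shows "f \<in> fare_set m" and "\<Lambda> \<in> multiplier_set m" and "x \<in> activation_set m"
  using assms by (auto simp: allied_optimum_def is_arg_max_def)

lemma allied_optimum_ge_full_price:
  assumes "valid_market m" and "allied_optimum m \<pi>PX \<pi>PR \<pi>VM f \<Lambda> x" and "g \<in> fare_set m"
  shows "alliance_objective m \<pi>PX \<pi>PR \<pi>VM (full_price m g)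
           \<le> alliance_objective m \<pi>PX \<pi>PR \<pi>VM (price m f \<Lambda> x)"
proof -
  have "0 \<in> multiplier_set m" and "(\<lambda>_. 0) \<in> activation_set m"
    using assms(1) by (auto simp: valid_market_def multiplier_set_def activation_set_def)
  with assms(3) show ?thesis
    \<comment> \<open>The competitor is \<open>g\<close> with zero multiplier and no activation,
      whose prices are the undiscounted ones.\<close>
    using assms(2)[unfolded allied_optimum_def is_arg_max_linorder, THEN conjunct2, THEN spec,
        of "(g, 0, \<lambda>_. 0)"]
    by (simp add: price_no_discount)
qed

lemma allied_profit_ge_noncoop:
  assumes "valid_market m" and "0 < \<pi>PR" and "allied_optimum m 0 \<pi>PR 0 f \<Lambda> x" and "g \<in> fare_set m"
  shows "(\<Sum>k\<in>UNIV. operator_profit m g k) \<le> alliance_profit m (price m f \<Lambda> x)"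
  using allied_optimum_ge_full_price[OF assms(1,3,4)] assms(2)
  by (simp add: alliance_objective_profit alliance_profit_full_price)

lemma allied_optimum_free:
  fixes m :: "('o::finite, 'r::finite, 'a, 'n::finite, 't::finite) market"
  assumes m: "valid_market m" and w: "0 \<le> \<pi>PX" "0 \<le> \<pi>VM" "0 < \<pi>PX + \<pi>VM"
    and cost: "\<And>k. unit_cost m k = 0"
    and opt: "allied_optimum m \<pi>PX 0 \<pi>VM f \<Lambda> x" and r: "r \<in> routes_of m i"
  shows "price m f \<Lambda> x r = 0"
proof (rule ccontr)
  \<comment> \<open>Zero fares lie in the fare set because all unit costs are zero.\<close>
  let ?z = "(\<lambda>_. 0, \<lambda>_. 0) :: 'o fares"
  have z: "?z \<in> fare_set m"
    using m cost by (auto simp: valid_market_def fare_set_def operator_fares_def less_imp_le)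
  have z0: "full_price m ?z = (\<lambda>_. 0)"
    by (simp add: full_price_def fun_eq_iff)
  have nonneg: "0 \<le> price m f \<Lambda> x q" for q
    by (rule price_nonneg[OF m allied_optimum_feasible[OF opt]])
  assume "price m f \<Lambda> x r \<noteq> 0"
  with nonneg[of r] have "0 < price m f \<Lambda> x r"
    by simp
  from alliance_objective_strict_antimono[where p = "\<lambda>_. 0" and q = "price m f \<Lambda> x",
      OF m w nonneg r this]
    allied_optimum_ge_full_price[OF m opt z]
  show False
    by (simp add: z0)
qed

lemma noncoop_profit_pos:
  fixes m :: "('o::finite, 'r::finite, 'a, 'n::finite, 't::finite) market"
  assumes m: "valid_market m" and eq: "noncoop_equilibrium m \<pi>PX \<pi>PR \<pi>VM f"
    and k: "k \<noteq> transit m"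
  shows "0 < operator_profit m f k"
proof -
  \<comment> \<open>A deviation of \<open>k\<close> to the upper corner of its fare box, where the
    base fare is positive; equilibrium bounds its profit from above.\<close>
  let ?g = "((fst f)(k := base_max m), (snd f)(k := rate_max m)) :: 'o fares"
  have dev: "(base_max m, rate_max m) \<in> operator_fares m k"
    using m by (auto simp: valid_market_def operator_fares_def)
  have "0 < operator_profit m ?g k"
    using m dev k by (intro operator_profit_pos) (auto simp: valid_market_def)
  also have "\<dots> \<le> operator_profit m f k"
    using eq dev k by (force simp: noncoop_equilibrium_def is_arg_max_linorder noncoop_payoff_def)
  finally show ?thesis .
qed

theorem lemma3:
  fixes m :: "('o::finite, 'r::finite, 'a, 'n::finite, 't::finite) market"
    and \<pi>PX \<pi>PR \<pi>VM :: real
    and fnc fa :: "'o fares" and \<Lambda>a :: real and xa :: "'a \<Rightarrow> real"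
    and \<Theta>nc :: "'o \<Rightarrow> real" and \<Theta>a \<delta> :: real
  assumes "valid_market m"
    and "\<pi>PX \<ge> 0" and "\<pi>PR \<ge> 0" and "\<pi>VM \<ge> 0"
    and "noncoop_equilibrium m \<pi>PX \<pi>PR \<pi>VM fnc"
    and "allied_optimum m \<pi>PX \<pi>PR \<pi>VM fa \<Lambda>a xa"
    and "\<Theta>nc = operator_profit m fnc"
    and "\<Theta>a = alliance_profit m (price m fa \<Lambda>a xa)"
    and "\<delta> = \<Theta>a - (\<Sum>k\<in>UNIV. \<Theta>nc k)"
  shows
    "(\<forall>k\<in>UNIV - {transit m}. payment_rule (transit m) \<Theta>nc \<Theta>a k \<ge> \<Theta>nc k) \<and>
     ((\<delta> \<ge> 0 \<longrightarrow> allocation_problem \<Theta>nc \<Theta>a) \<and>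
      pareto_efficient (payment_rule (transit m)) \<and>
      symmetric_mechanism (payment_rule (transit m)) \<and>
      core_property (payment_rule (transit m)) \<and>
      scale_invariant (payment_rule (transit m)) \<and>
      independent_of_irrelevant_alternatives (payment_rule (transit m))) \<and>
     ((\<pi>PR > 0 \<and> \<pi>PX = 0 \<and> \<pi>VM = 0 \<longrightarrow> \<delta> \<ge> 0) \<and>
      (\<pi>PR = 0 \<and> \<pi>PX + \<pi>VM > 0 \<and> (\<forall>k. unit_cost m k = 0) \<longrightarrow> \<delta> < 0))"
proof -
  note m = assms(1) and eq = assms(5) and opt = assms(6)
  have fnc: "fnc \<in> fare_set m"
    using eq by (simp add: noncoop_equilibrium_def)
  \<comment> \<open>This covers the transit operator as well: whatever it maximizes, its rate is at
    least its unit cost.\<close>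
  have nonneg: "0 \<le> \<Theta>nc k" for k
    using fnc by (simp add: assms(7) operator_profit_nonneg[OF m] fare_set_def)
  have "\<delta> < 0" if w: "\<pi>PR = 0" "0 < \<pi>PX + \<pi>VM" and cost: "\<forall>k. unit_cost m k = 0"
  proof -
    have "price m fa \<Lambda>a xa r = 0" if "r \<in> routes_of m i" for r i
      using allied_optimum_free[OF m assms(2,4) w(2) _ _ that] cost opt w(1) by simp
    then have "\<Theta>a = 0"
      by (simp add: assms(8) alliance_profit_def cost)
    moreover obtain k where "k \<noteq> transit m"
      using m by (auto simp: valid_market_def)
    then have "0 < \<Theta>nc k"
      using noncoop_profit_pos[OF m eq] by (simp add: assms(7))
    then have "0 < (\<Sum>k\<in>UNIV. \<Theta>nc k)"
      using nonneg by (intro sum_pos2[where i = k]) auto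
    ultimately show ?thesis
      by (simp add: assms(9))
  qed
  moreover have "0 \<le> \<delta>" if "\<pi>PR > 0 \<and> \<pi>PX = 0 \<and> \<pi>VM = 0"
    using allied_profit_ge_noncoop[OF m _ _ fnc, of \<pi>PR fa \<Lambda>a xa] that opt by (simp add: assms(7-9))
  \<comment> \<open>The positive part protects these operators for either sign of
    \<open>\<delta>\<close>; a loss falls on transit alone.\<close>
  moreover have "\<forall>k\<in>UNIV - {transit m}. \<Theta>nc k \<le> payment_rule (transit m) \<Theta>nc \<Theta>a k"
    by (simp add: payment_rule_def Let_def)
  moreover have "\<delta> \<ge> 0 \<longrightarrow> allocation_problem \<Theta>nc \<Theta>a"
    by (simp add: allocation_problem_def nonneg assms(9))
  ultimately show ?thesis
    by (simp add: pareto_efficient_payment_rule symmetric_payment_rule core_property_payment_rule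
        scale_invariant_payment_rule independent_payment_rule)
qed

end
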